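(* Let $(\sigma,s,\omega_s)$ be a data with $\omega_s=(\mathbf b,r,Z)$, $Z(u)=\sum_{i=0}^r z_iu^i$, and let $\psi_{\sigma,s,\omega_s}$ be its cluster symmetric map. Let $t=\sigma^{-1}(s)$. Let $\bm{\eta}\in\mathbb Z_{\ge0}^n$, $\mathbf d\in\mathbb Z^n$ satisfy $\mathbf d=\sigma(\mathbf d)$ and $\eta_s=\eta_t=2d_s=2d_t$, and let $F(\mathbf x)\in\mathbb Q[\mathbf x^{\pm}]$ be a Laurent polynomial of type $\frac{\bm\eta}{\mathbf d}$ with expansion $F(\mathbf x)=\mathbf x^{-\mathbf d}\sum_{\mathbf j\in\mathcal N}a_{\mathbf j}\mathbf x^{\mathbf j}$, where $\mathcal N=\{\mathbf j\in\mathbb Z_{\ge0}^n : 0\le j_i\le\eta_i \text{ for all } i\in[1,n]\}$ and $a_{\mathbf j}\in\mathbb Q$. Then $$F(\psi_{\sigma,s,\omega_s}(\mathbf x))=F(\mathbf x)$$ holds if and only if the coefficients $\{a_{\mathbf j}\mid \mathbf j\in\mathcal N\}$ satisfy the system of homogeneous linear equations $HLE(\sigma,s,\omega_s,\bm\eta,\mathbf d)$ defined in the context.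
   Context: Fix $n\ge1$ and indeterminates $\mathbf x=(x_1,\dots,x_n)$; $[a,b]$ denotes the integers between $a$ and $b$; $\mathbf x^{\mathbf v}=\prod x_i^{v_i}$; $\mathbf e_k$ are the standard basis vectors. For $\sigma\in\mathfrak S_n$ and an $n$-tuple $\mathbf v$, $\sigma(\mathbf v)=(v_{\sigma(1)},\dots,v_{\sigma(n)})$; for a set $S$ of $n$-tuples, $\sigma(S)=\{\sigma(\mathbf j):\mathbf j\in S\}$ and $S+\mathbf v=\{\mathbf a+\mathbf v:\mathbf a\in S\}$. $[a]_+=\max\{a,0\}$, applied componentwise to tuples. For a set $S$ of $n$-tuples and an integer $i$, $\pi_k^{(i)}(S)=\{\mathbf j\in S: j_k=i\}$. A seedlet at direction $s\in[1,n]$ is a triple $\omega_s=(\mathbf b,r,Z)$ with $\mathbf b\in\mathbb Z^n$, $b_s=0$, $r$ a positive integer, and $Z(u)=\sum_{i=0}^r z_iu^i\in\mathbb Z_{\ge0}[u]$ with $z_0,z_r>0$. Its exchange polynomial is $P_{\omega_s}(\mathbf x)=\mathbf x^{r[-\mathbf b]_+}Z(\mathbf x^{\mathbf b})=\sum_{i=0}^r z_i\mathbf x^{i[\mathbf b]_++(r-i)[-\mathbf b]_+}$. A data is a triple $(\sigma,s,\omega_s)$ with $\sigma\in\mathfrak S_n$, $s\in[1,n]$ and $\omega_s$ a seedlet at direction $s$. With $t=\sigma^{-1}(s)$, its cluster symmetric map $\psi_{\sigma,s,\omega_s}(\mathbf x)$ is the $n$-tuple whose $i$-th component is $x_{\sigma(i)}$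 for $i\ne t$ and whose $t$-th component is $P_{\omega_s}(\mathbf x)/x_s$. A Laurent polynomial $F$ is of type $\frac{\bm\eta}{\mathbf d}$ if $F=T(\mathbf x)/\mathbf x^{\mathbf d}$ with $T\in\mathbb Q[\mathbf x]$, $\mathbf d\in\mathbb Z^n$, $x_i\nmid T$ for all $i$, and $\eta_i$ is the degree of $T$ in $x_i$. The system. For $k,l\ge0$ let $c_{k,l}=\sum_{l_1,\dots,l_k\in[0,r],\,l_1+\cdots+l_k=l}z_{l_1}\cdots z_{l_k}$ if $k>0$ and $c_{0,l}=1$. For a data $(\sigma,s,\omega_s)$ with $\omega_s=(\mathbf b,r,Z)$, let $\mathbf b_{s,k,l}^{(i)}=l[\mathbf b]_++(kr-l)[-\mathbf b]_+-i\mathbf e_s$. For $k\in[0,d_s]$, $HLE(\sigma,s,\omega_s,\bm\eta,\mathbf d,k)$ consists of the following equations, in which $U_k:=\bigcup_{0\le l\le kr}(\mathcal N+\mathbf b_{s,k,l}^{(2k)})$: (1) for every $\mathbf j\in\pi_s^{(d_s-k)}(\sigma^{-1}(\mathcal N)\cap U_k)$: $\;0=a_{\sigma(\mathbf j)}-\sum_{0\le l\le kr,\ \mathbf j-\mathbf b_{s,k,l}^{(2k)}\in\mathcal N}a_{\mathbf j-\mathbf b_{s,k,l}^{(2k)}}c_{k,l}$; (2) for every $\mathbf j\in\pi_s^{(d_s-k)}(U_k\setminus\sigma^{-1}(\mathcal N))$: $\;0=\sum_{0\le l\le kr,\ \mathbf j-\mathbf b_{s,k,l}^{(2k)}\in\mathcal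 N}a_{\mathbf j-\mathbf b_{s,k,l}^{(2k)}}c_{k,l}$; (3) for every $\mathbf j\in\pi_s^{(d_s-k)}(\sigma^{-1}(\mathcal N)\setminus U_k)$: $\;0=a_{\sigma(\mathbf j)}$. Let $t=\sigma^{-1}(s)$ and $\omega_t=(\sigma(\mathbf b),r,Z)$, a seedlet at direction $t$. The system $HLE(\sigma^{-1},t,\omega_t,\bm\eta,\mathbf d,k)$ is obtained from the same definition with $(\sigma,s,\mathbf b)$ replaced by $(\sigma^{-1},t,\sigma(\mathbf b))$. Finally $HLE(\sigma,s,\omega_s,\bm\eta,\mathbf d)$ is the union of all systems $HLE(\sigma,s,\omega_s,\bm\eta,\mathbf d,k)$ and $HLE(\sigma^{-1},t,\omega_t,\bm\eta,\mathbf d,k)$ for $k\in[0,d_s]$. *)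

theory Defs
  imports
    "HOL-Analysis.Finite_Cartesian_Product"
    "HOL-Library.Poly_Mapping"
    "HOL-Computational_Algebra.Polynomial"
    "HOL-Computational_Algebra.Fraction_Field"
begin

text \<open>
  The index set [1,n] is a finite linearly ordered type \<open>'n\<close> (nonempty, so n is at least 1),
  and n-tuples of integers are vectors of type \<open>'n int_tuple\<close>, that is \<open>int ^ 'n\<close>. The order on \<open>'n\<close> serves only
  to make the polynomial ring an instance of \<open>idom\<close>, as needed for its fraction field.
\<close>

subsection \<open>Polynomials, Laurent polynomials and rational functions\<close>

type_synonym 'n int_tuple = "(int, 'n) vec"

type_synonym 'n nat_tuple = "(nat, 'n) vec"

type_synonym 'n mpol = "('n \<Rightarrow>\<^sub>0 nat) \<Rightarrow>\<^sub>0 rat"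

type_synonym 'n laurent_pol = "'n int_tuple \<Rightarrow>\<^sub>0 rat"

type_synonym 'n rat_fun = "'n mpol fract"

definition mpol_var :: "'n::{finite,linorder} \<Rightarrow> 'n mpol" where
  "mpol_var i = Poly_Mapping.single (Poly_Mapping.single i 1) 1"

text \<open>Only meaningful for \<open>T \<noteq> 0\<close>.\<close>

definition degree_in :: "'n::{finite,linorder} \<Rightarrow> 'n mpol \<Rightarrow> nat" where
  "degree_in i T = Max ((\<lambda>m. Poly_Mapping.lookup m i) ` Poly_Mapping.keys T)"

definition rat_fun_of :: "'n::{finite,linorder} mpol \<Rightarrow> 'n rat_fun" where
  "rat_fun_of T = Fract T 1"

definition rat_fun_const :: "rat \<Rightarrow> 'n::{finite,linorder} rat_fun" where
  "rat_fun_const q = rat_fun_of (Poly_Mapping.single 0 q)"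

definition rat_fun_var :: "'n::{finite,linorder} \<Rightarrow> 'n rat_fun" where
  "rat_fun_var i = rat_fun_of (mpol_var i)"

definition tuple_power :: "('n::finite \<Rightarrow> 'a::field) \<Rightarrow> 'n int_tuple \<Rightarrow> 'a" where
  "tuple_power y v = (\<Prod>i\<in>UNIV. y i powi (v $ i))"

text \<open>
  Substitution of a tuple of (nonzero) rational functions into a Laurent polynomial;
  \<open>laurent_subst F rat_fun_var\<close> is F itself, as an element of the field of rational functions.
\<close>

definition laurent_subst :: "'n::{finite,linorder} laurent_pol \<Rightarrow> ('n \<Rightarrow> 'n rat_fun) \<Rightarrow> 'n rat_fun" where
  "laurent_subst F y =
     (\<Sum>v\<in>Poly_Mapping.keys F. rat_fun_const (Poly_Mapping.lookup F v) * tuple_power y v)"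

text \<open>The Laurent monomial with coefficient c and exponent v.\<close>

definition laurent_monom :: "rat \<Rightarrow> 'n int_tuple \<Rightarrow> 'n::{finite,linorder} laurent_pol" where
  "laurent_monom c v = Poly_Mapping.single v c"

definition of_type :: "'n::{finite,linorder} laurent_pol \<Rightarrow> 'n nat_tuple \<Rightarrow> 'n int_tuple \<Rightarrow> bool" where
  "of_type F \<eta> d \<longleftrightarrow>
     (\<exists>T :: 'n mpol. laurent_subst F rat_fun_var = rat_fun_of T / tuple_power rat_fun_var d
        \<and> (\<forall>i. \<not> mpol_var i dvd T) \<and> (\<forall>i. \<eta> $ i = degree_in i T))"


subsection \<open>Tuples\<close>

definition perm_tuple :: "('n \<Rightarrow> 'n) \<Rightarrow> 'a ^ 'n::finite \<Rightarrow> 'a ^ 'n::finite" where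
  "perm_tuple \<sigma> v = (\<chi> i. v $ \<sigma> i)"

definition pos_tuple :: "'n int_tuple \<Rightarrow> 'n::finite int_tuple" where
  "pos_tuple v = (\<chi> i. max (v $ i) 0)"

definition slice :: "'n \<Rightarrow> int \<Rightarrow> ('n int_tuple) set \<Rightarrow> ('n::finite int_tuple) set" where
  "slice k i S = {j \<in> S. j $ k = i}"

definition box_of :: "'n nat_tuple \<Rightarrow> ('n::finite int_tuple) set" where
  "box_of \<eta> = {j. \<forall>i. 0 \<le> j $ i \<and> j $ i \<le> int (\<eta> $ i)}"


subsection \<open>Seedlets and cluster symmetric maps\<close>

text \<open>
  A seedlet (b, r, Z) is passed as three separate arguments; the polynomial Z with
  nonnegative integer coefficients has type \<open>nat poly\<close>.
\<close>

definition is_seedlet :: "'n::finite \<Rightarrow> 'n int_tuple \<Rightarrow> nat \<Rightarrow> nat poly \<Rightarrow> bool" where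
  "is_seedlet s b r Z \<longleftrightarrow>
     b $ s = 0 \<and> r > 0 \<and> degree Z \<le> r \<and> coeff Z 0 > 0 \<and> coeff Z r > 0"

definition is_data :: "('n \<Rightarrow> 'n) \<Rightarrow> 'n::finite \<Rightarrow> 'n int_tuple \<Rightarrow> nat \<Rightarrow> nat poly \<Rightarrow> bool" where
  "is_data \<sigma> s b r Z \<longleftrightarrow> bij \<sigma> \<and> is_seedlet s b r Z"

definition exchange_poly :: "'n int_tuple \<Rightarrow> nat \<Rightarrow> nat poly \<Rightarrow> 'n::{finite,linorder} rat_fun" where
  "exchange_poly b r Z =
     tuple_power rat_fun_var (int r *s pos_tuple (- b))
       * poly (map_poly of_nat Z) (tuple_power rat_fun_var b)"

definition cluster_sym_map ::
    "('n \<Rightarrow> 'n) \<Rightarrow> 'n \<Rightarrow> 'n int_tuple \<Rightarrow> nat \<Rightarrow> nat poly \<Rightarrow> 'n::{finite,linorder} \<Rightarrow> 'n rat_fun" where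
  "cluster_sym_map \<sigma> s b r Z i =
     (if i = inv \<sigma> s then exchange_poly b r Z / rat_fun_var s else rat_fun_var (\<sigma> i))"


subsection \<open>The system of homogeneous linear equations\<close>

definition c_coeff :: "nat \<Rightarrow> nat poly \<Rightarrow> nat \<Rightarrow> nat \<Rightarrow> nat" where
  "c_coeff r Z k l =
     (if k = 0 then 1
      else \<Sum>ls | length ls = k \<and> set ls \<subseteq> {0..r} \<and> sum_list ls = l. prod_list (map (coeff Z) ls))"

definition b_vec :: "'n int_tuple \<Rightarrow> nat \<Rightarrow> 'n \<Rightarrow> nat \<Rightarrow> nat \<Rightarrow> int \<Rightarrow> 'n::finite int_tuple" where
  "b_vec b r s k l i =
     int l *s pos_tuple b + (int (k * r) - int l) *s pos_tuple (- b) - i *s axis s 1"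

definition U_set :: "'n \<Rightarrow> 'n int_tuple \<Rightarrow> nat \<Rightarrow> 'n nat_tuple \<Rightarrow> nat \<Rightarrow> ('n::finite int_tuple) set" where
  "U_set s b r \<eta> k = (\<Union>l\<in>{0..k * r}. (\<lambda>j. j + b_vec b r s k l (2 * int k)) ` box_of \<eta>)"

definition HLE_sum ::
    "('n int_tuple \<Rightarrow> rat) \<Rightarrow> 'n \<Rightarrow> 'n int_tuple \<Rightarrow> nat \<Rightarrow> nat poly \<Rightarrow> 'n nat_tuple \<Rightarrow> nat \<Rightarrow> 'n::finite int_tuple \<Rightarrow> rat" where
  "HLE_sum a s b r Z \<eta> k j =
     (\<Sum>l | l \<le> k * r \<and> j - b_vec b r s k l (2 * int k) \<in> box_of \<eta>.
        a (j - b_vec b r s k l (2 * int k)) * of_nat (c_coeff r Z k l))"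

text \<open>
  \<open>HLE_k a \<sigma> s b r Z \<eta> d k\<close> states that the family a satisfies
  \<open>HLE(\<sigma>, s, (b, r, Z), \<eta>, d, k)\<close>. Only values of a on \<open>box_of \<eta>\<close> occur. For a bijection
  \<open>\<sigma>\<close> the set \<open>\<sigma>\<^sup>-\<^sup>1(N)\<close> (with \<open>N = box_of \<eta>\<close>) is the image of N under \<open>perm_tuple (inv \<sigma>)\<close>.
\<close>

definition HLE_k ::
    "('n int_tuple \<Rightarrow> rat) \<Rightarrow> ('n \<Rightarrow> 'n) \<Rightarrow> 'n \<Rightarrow> 'n int_tuple \<Rightarrow> nat \<Rightarrow> nat poly \<Rightarrow> 'n nat_tuple \<Rightarrow> 'n::finite int_tuple
      \<Rightarrow> nat \<Rightarrow> bool" where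
  "HLE_k a \<sigma> s b r Z \<eta> d k \<longleftrightarrow>
     (let N' = perm_tuple (inv \<sigma>) ` box_of \<eta>; U = U_set s b r \<eta> k; e = d $ s - int k in
        (\<forall>j \<in> slice s e (N' \<inter> U). 0 = a (perm_tuple \<sigma> j) - HLE_sum a s b r Z \<eta> k j)
      \<and> (\<forall>j \<in> slice s e (U - N'). 0 = HLE_sum a s b r Z \<eta> k j)
      \<and> (\<forall>j \<in> slice s e (N' - U). 0 = a (perm_tuple \<sigma> j)))"

text \<open>
  The second family of equations belongs to the inverse permutation and the seedlet
  \<open>(perm_tuple \<sigma> b, r, Z)\<close> at direction \<open>inv \<sigma> s\<close>.
\<close>

definition HLE ::
    "('n int_tuple \<Rightarrow> rat) \<Rightarrow> ('n \<Rightarrow> 'n) \<Rightarrow> 'n \<Rightarrow> 'n int_tuple \<Rightarrow> nat \<Rightarrow> nat poly \<Rightarrow> 'n nat_tuple \<Rightarrow> 'n::finite int_tuple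
      \<Rightarrow> bool" where
  "HLE a \<sigma> s b r Z \<eta> d \<longleftrightarrow>
     (\<forall>k::nat. int k \<le> d $ s \<longrightarrow>
        HLE_k a \<sigma> s b r Z \<eta> d k
      \<and> HLE_k a (inv \<sigma>) (inv \<sigma> s) (perm_tuple \<sigma> b) r Z \<eta> d k)"

end

theory Submission
  imports Defs
begin

text \<open>
  Put \<open>Q = P / x\<^sub>s\<^sup>2\<close> with P the exchange polynomial, and \<open>D = d\<^sub>s\<close>. Up to a permutation of the variables,
  the cluster symmetric map multiplies the monomial \<open>x^(j - d)\<close> by \<open>Q^(j\<^sub>t - D)\<close>. Splitting F into its
  components \<open>H\<^sub>e\<close> of degree e in \<open>x\<^sub>s\<close>, the invariance of F reads \<open>\<Sum>\<^sub>e Q^(-e) G\<^sub>e = \<Sum>\<^sub>e H\<^sub>e\<close> for Laurent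
  polynomials \<open>G\<^sub>e\<close> supported in degree -e. Multiplication by \<open>Q^D\<close> turns both sides into Laurent
  polynomials, and since \<open>P\<close> does not involve \<open>x\<^sub>s\<close> they can be compared degree by degree in \<open>x\<^sub>s\<close>. The
  components \<open>e = k \<ge> 0\<close>, namely \<open>G\<^sub>k = Q^k H\<^sub>k\<close>, give the system for \<open>\<sigma>\<close>, and the components \<open>e = -k\<close>, namely
  \<open>Q^k G\<^sub>-\<^sub>k = H\<^sub>-\<^sub>k\<close>, give the system for the inverse of \<open>\<sigma>\<close>.
\<close>

subsection \<open>Powers of the polynomial of a seedlet\<close>

lemma map_poly_of_nat_mult:
  "map_poly (of_nat :: nat \<Rightarrow> 'a::comm_semiring_1) (p * q) = map_poly of_nat p * map_poly of_nat q"
  by (rule poly_eqI) (simp add: coeff_map_poly coeff_mult)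

lemma map_poly_of_nat_power:
  "map_poly (of_nat :: nat \<Rightarrow> 'a::comm_semiring_1) (p ^ k) = map_poly of_nat p ^ k"
  by (induction k) (simp_all add: map_poly_of_nat_mult)

lemma poly_map_of_nat_eq_sum:
  assumes "degree p \<le> m"
  shows "poly (map_poly of_nat p) (y :: 'a::comm_ring_1) = (\<Sum>l\<le>m. of_nat (coeff p l) * y ^ l)"
proof -
  have "degree (map_poly of_nat p :: 'a poly) \<le> m"
    using map_poly_degree_leq assms by (rule order_trans)
  then have "poly (map_poly of_nat p) y = (\<Sum>l\<le>m. coeff (map_poly of_nat p) l * y ^ l)"
    unfolding poly_altdef by (intro sum.mono_neutral_left) (auto simp: coeff_eq_0)
  then show ?thesis
    by (simp add: coeff_map_poly)
qed

text \<open>Cauchy product for \<open>Z * Z ^ k\<close>: a list of length \<open>Suc k\<close>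
  splits into its head, the index taken from the first factor, and its tail. Entries above
  \<open>r\<close> would contribute zero coefficients, so the restriction to \<open>{0..r}\<close>
  loses nothing.\<close>

lemma coeff_power_eq_sum_lists:
  assumes "degree Z \<le> r"
  shows "coeff (Z ^ k) l =
    (\<Sum>ls | length ls = k \<and> set ls \<subseteq> {0..r} \<and> sum_list ls = l. prod_list (map (coeff Z) ls))"
    (is "_ = sum ?w (?A k l)")
proof (induction k arbitrary: l)
  case 0
  have "?A 0 l = (if l = 0 then {[]} else {})"
    by auto
  then show ?case
    by simp
next
  case (Suc k)
  have fin: "finite (?A k l')" for l'
    by (rule finite_subset[OF _ finite_lists_length_eq[of "{0..r}" k]]) auto
  let ?I = "{i. i \<le> l \<and> i \<le> r}"
  have "coeff (Z ^ Suc k) l = (\<Sum>i\<le>l. coeff Z i * coeff (Z ^ k) (l - i))"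
    by (simp add: coeff_mult)
  also have "\<dots> = (\<Sum>i\<in>?I. coeff Z i * coeff (Z ^ k) (l - i))"
  proof (rule sum.mono_neutral_right)
    show "\<forall>i\<in>{..l} - ?I. coeff Z i * coeff (Z ^ k) (l - i) = 0"
    proof
      fix i assume "i \<in> {..l} - ?I"
      then have "r < i" by auto
      then show "coeff Z i * coeff (Z ^ k) (l - i) = 0"
        using assms by (simp add: coeff_eq_0)
    qed
  qed auto
  also have "\<dots> = (\<Sum>i\<in>?I. \<Sum>ls\<in>?A k (l - i). coeff Z i * ?w ls)"
    by (simp add: Suc sum_distrib_left)
  also have "\<dots> = (\<Sum>(i, ls)\<in>Sigma ?I (\<lambda>i. ?A k (l - i)). coeff Z i * ?w ls)"
    using fin by (intro sum.Sigma) auto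
  also have "\<dots> = sum ?w (?A (Suc k) l)"
    by (rule sum.reindex_bij_witness[where i = "\<lambda>ls. (hd ls, tl ls)" and j = "\<lambda>(i, ls). i # ls"])
      (auto simp: length_Suc_conv)
  finally show ?case .
qed

text \<open>The convention c(0,l) = 1 agrees with the coefficients of \<open>Z ^ 0\<close> only at l
  = 0; for k = 0 the bound on \<open>l\<close> leaves exactly this case.\<close>

lemma c_coeff_eq_coeff_power:
  assumes "degree Z \<le> r" and "l \<le> k * r"
  shows "c_coeff r Z k l = coeff (Z ^ k) l"
  using assms by (cases "k = 0") (simp_all add: c_coeff_def coeff_power_eq_sum_lists)

subsection \<open>Substitution into Laurent polynomials\<close>

lemma lookup_single_mult:
  fixes F :: "'a::ab_group_add \<Rightarrow>\<^sub>0 'b::comm_semiring_0"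
  shows "Poly_Mapping.lookup (Poly_Mapping.single u c * F) w = c * Poly_Mapping.lookup F (w - u)"
proof -
  have "(\<Sum>q. Poly_Mapping.lookup F q when w = u + q) = (\<Sum>q. Poly_Mapping.lookup F q when w - u = q)"
    by (intro arg_cong[where f = Sum_any] ext when_cong) (auto simp: algebra_simps)
  then show ?thesis
    by (simp add: lookup_mult lookup_single when_mult Sum_any_when_independent)
qed

section \<open>Polynomials and constants inside the field of rational functions\<close>

lemma rat_fun_of_0 [simp]: "rat_fun_of 0 = 0"
  by (simp add: rat_fun_of_def Zero_fract_def)

lemma rat_fun_of_1 [simp]: "rat_fun_of 1 = 1"
  by (simp add: rat_fun_of_def One_fract_def)

lemma rat_fun_of_add: "rat_fun_of (p + q) = rat_fun_of p + rat_fun_of q"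
  by (simp add: rat_fun_of_def)

lemma rat_fun_of_mult: "rat_fun_of (p * q) = rat_fun_of p * rat_fun_of q"
  by (simp add: rat_fun_of_def)

lemma rat_fun_of_sum: "rat_fun_of (sum f A) = (\<Sum>x\<in>A. rat_fun_of (f x))"
  by (induction A rule: infinite_finite_induct) (simp_all add: rat_fun_of_add)

lemma rat_fun_of_power: "rat_fun_of (p ^ k) = rat_fun_of p ^ k"
  by (induction k) (simp_all add: rat_fun_of_mult)

lemma rat_fun_of_prod: "rat_fun_of (prod f A) = (\<Prod>x\<in>A. rat_fun_of (f x))"
  by (induction A rule: infinite_finite_induct) (simp_all add: rat_fun_of_mult)

lemma rat_fun_of_eq_0_iff [simp]: "rat_fun_of p = 0 \<longleftrightarrow> p = 0"
  by (simp add: rat_fun_of_def Zero_fract_def eq_fract)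

lemma rat_fun_const_0 [simp]: "rat_fun_const 0 = 0"
  by (simp add: rat_fun_const_def)

lemma rat_fun_const_1 [simp]: "rat_fun_const 1 = 1"
  by (simp add: rat_fun_const_def)

lemma rat_fun_const_add: "rat_fun_const (p + q) = rat_fun_const p + rat_fun_const q"
  by (simp add: rat_fun_const_def single_add rat_fun_of_add)

lemma rat_fun_const_mult: "rat_fun_const (p * q) = rat_fun_const p * rat_fun_const q"
  by (simp add: rat_fun_const_def flip: rat_fun_of_mult) (simp add: mult_single)

lemma rat_fun_const_of_nat [simp]: "rat_fun_const (of_nat m) = of_nat m"
  by (induction m) (simp_all add: rat_fun_const_add)

lemma rat_fun_var_nonzero [simp]: "rat_fun_var i \<noteq> 0"
  by (simp add: rat_fun_var_def mpol_var_def) (metis lookup_single_eq lookup_zero zero_neq_one)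

section \<open>Substitution as a ring homomorphism\<close>

lemma tuple_power_add:
  assumes "\<And>i. y i \<noteq> 0"
  shows "tuple_power y (u + v) = tuple_power y u * tuple_power y v"
  using assms by (simp add: tuple_power_def power_int_add prod.distrib)

lemma tuple_power_of_nat:
  assumes "\<And>i. y i \<noteq> 0"
  shows "tuple_power y (int k *s v) = tuple_power y v ^ k"
  by (simp add: tuple_power_def power_int_mult mult.commute[of "int k"] prod_power_distrib)

lemma laurent_subst_superset:
  assumes "finite S" and "Poly_Mapping.keys F \<subseteq> S"
  shows "laurent_subst F y =
    (\<Sum>v\<in>S. rat_fun_const (Poly_Mapping.lookup F v) * tuple_power y v)"
  unfolding laurent_subst_def using assms
  by (intro sum.mono_neutral_left) (auto simp: in_keys_iff)

lemma laurent_subst_single: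
  "laurent_subst (Poly_Mapping.single v c) y = rat_fun_const c * tuple_power y v"
  by (subst laurent_subst_superset[of "{v}"]) (simp_all split: if_splits)

lemma laurent_subst_0 [simp]: "laurent_subst 0 y = 0"
  by (simp add: laurent_subst_def)

lemma laurent_subst_add: "laurent_subst (F + G) y = laurent_subst F y + laurent_subst G y"
proof -
  let ?S = "Poly_Mapping.keys F \<union> Poly_Mapping.keys G"
  have "finite ?S" "Poly_Mapping.keys (F + G) \<subseteq> ?S"
    by (simp_all add: keys_add)
  then show ?thesis
    by (simp add: laurent_subst_superset[of ?S] lookup_add rat_fun_const_add distrib_right sum.distrib)
qed

lemma laurent_subst_sum: "laurent_subst (sum f A) y = (\<Sum>x\<in>A. laurent_subst (f x) y)"
  by (induction A rule: infinite_finite_induct) (simp_all add: laurent_subst_add)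

lemma poly_mapping_eq_sum_single:
  "F = (\<Sum>v\<in>Poly_Mapping.keys F. Poly_Mapping.single v (Poly_Mapping.lookup F v))"
  by (rule poly_mapping_eqI)
    (auto simp: lookup_sum lookup_single when_def in_keys_iff sum.delta' if_distrib cong: if_cong)

lemma laurent_subst_mult:
  assumes "\<And>i. y i \<noteq> 0"
  shows "laurent_subst (F * G) y = laurent_subst F y * laurent_subst G y"
proof -
  have "F * G = (\<Sum>u\<in>Poly_Mapping.keys F. \<Sum>v\<in>Poly_Mapping.keys G.
      Poly_Mapping.single (u + v) (Poly_Mapping.lookup F u * Poly_Mapping.lookup G v))"
    by (subst poly_mapping_eq_sum_single[of F], subst poly_mapping_eq_sum_single[of G])
      (simp add: sum_product mult_single)
  then show ?thesis
    using assms
    by (simp add: laurent_subst_sum laurent_subst_single laurent_subst_def[of F] laurent_subst_def[of G]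
        sum_product rat_fun_const_mult tuple_power_add mult_ac)
qed

lemma laurent_subst_diff: "laurent_subst (F - G) y = laurent_subst F y - laurent_subst G y"
  using laurent_subst_add[of "F - G" G y] by simp

section \<open>Laurent polynomials embed into the rational functions\<close>

definition nat_exponent :: "'n int_tuple \<Rightarrow> ('n::{finite,linorder} \<Rightarrow>\<^sub>0 nat)" where
  "nat_exponent v = Abs_poly_mapping (\<lambda>i. nat (v $ i))"

text \<open>Negative entries are truncated to 0, so \<open>nat_exponent\<close> is faithful on
  nonnegative vectors only; denominators have to be cleared first.\<close>

lemma lookup_nat_exponent: "Poly_Mapping.lookup (nat_exponent v) i = nat (v $ i)"
  by (simp add: nat_exponent_def)

lemma prod_single:
  "(\<Prod>i\<in>A. Poly_Mapping.single (f i) (1::rat)) = Poly_Mapping.single (\<Sum>i\<in>A. f i :: 'a::comm_monoid_add) 1"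
  by (induction A rule: infinite_finite_induct) (simp_all add: mult_single)

lemma tuple_power_var_nonneg:
  assumes "\<And>i. 0 \<le> v $ i"
  shows "tuple_power rat_fun_var v = rat_fun_of (Poly_Mapping.single (nat_exponent v) 1)"
proof -
  have *: "mpol_var i ^ k = Poly_Mapping.single (Poly_Mapping.single i k) 1" for i :: 'a and k
    by (induction k) (simp_all add: mpol_var_def mult_single flip: single_add)
  have "tuple_power rat_fun_var v = (\<Prod>i\<in>UNIV. rat_fun_var i ^ nat (v $ i))"
    using assms by (simp add: tuple_power_def power_int_def)
  also have "\<dots> = rat_fun_of (\<Prod>i\<in>UNIV. Poly_Mapping.single (Poly_Mapping.single i (nat (v $ i))) 1)"
    by (simp add: rat_fun_var_def * flip: rat_fun_of_prod rat_fun_of_power)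
  also have "(\<Sum>i\<in>UNIV. Poly_Mapping.single i (nat (v $ i))) = nat_exponent v"
    by (rule poly_mapping_eqI) (simp add: lookup_sum lookup_nat_exponent lookup_single when_def)
  then have "(\<Prod>i\<in>UNIV. Poly_Mapping.single (Poly_Mapping.single i (nat (v $ i))) 1)
      = Poly_Mapping.single (nat_exponent v) (1::rat)"
    by (simp add: prod_single)
  finally show ?thesis .
qed

text \<open>A large monomial x^w clears all denominators of F. The product is a genuine polynomial
  T, polynomials embed into their fraction field, and T has the same coefficients as F at shifted
  exponents.\<close>

lemma laurent_subst_var_eq_0_iff: "laurent_subst F rat_fun_var = 0 \<longleftrightarrow> F = 0"
proof
  assume F: "laurent_subst F rat_fun_var = 0"
  define K where "K = Poly_Mapping.keys F"
  \<comment> \<open>Summing absolute values over the whole support makes w + v nonnegative for every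
    exponent v of F.\<close>
  define w :: "'a int_tuple" where "w = (\<chi> i. \<Sum>v\<in>K. \<bar>v $ i\<bar>)"
  have nonneg: "0 \<le> (w + v) $ i" if "v \<in> K" for v i
  proof -
    have "\<bar>v $ i\<bar> \<le> w $ i"
      unfolding w_def using member_le_sum[OF that, of "\<lambda>v. \<bar>v $ i\<bar>"] by (simp add: K_def)
    then show ?thesis by simp
  qed
  define T where "T = (\<Sum>v\<in>K. Poly_Mapping.single (nat_exponent (w + v)) (Poly_Mapping.lookup F v))"
  have "rat_fun_of T = (\<Sum>v\<in>K. rat_fun_const (Poly_Mapping.lookup F v) * tuple_power rat_fun_var (w + v))"
    using nonneg
    by (simp add: T_def rat_fun_of_sum tuple_power_var_nonneg rat_fun_const_def mult_single
        flip: rat_fun_of_mult)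
  also have "\<dots> = tuple_power rat_fun_var w * laurent_subst F rat_fun_var"
    by (simp add: laurent_subst_def K_def tuple_power_add sum_distrib_left mult_ac)
  finally have T: "T = 0"
    by (simp add: F)
  have "K = {}"
  proof (rule ccontr)
    assume "K \<noteq> {}"
    then obtain u where u: "u \<in> K" by auto
    have inj: "v = u" if "v \<in> K" "nat_exponent (w + v) = nat_exponent (w + u)" for v
    proof -
      have "nat ((w + v) $ i) = nat ((w + u) $ i)" for i
        using that(2) by (metis lookup_nat_exponent)
      then show ?thesis
        using nonneg[OF that(1)] nonneg[OF u] by (simp add: vec_eq_iff nat_eq_iff2)
    qed
    have "Poly_Mapping.lookup T (nat_exponent (w + u)) =
        (\<Sum>v\<in>K. if v = u then Poly_Mapping.lookup F v else 0)"
      unfolding T_def lookup_sum lookup_single when_def using inj by (intro sum.cong) auto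
    also have "\<dots> = Poly_Mapping.lookup F u"
      using u by (simp add: K_def)
    finally show False
      using u T by (simp add: K_def in_keys_iff)
  qed
  then show "F = 0"
    by (simp add: K_def)
qed simp

lemma laurent_subst_var_inject:
  "laurent_subst F rat_fun_var = laurent_subst G rat_fun_var \<longleftrightarrow> F = G"
  using laurent_subst_var_eq_0_iff[of "F - G"] by (simp add: laurent_subst_diff)

subsection \<open>Tuples\<close>

lemma perm_tuple_nth [simp]: "perm_tuple \<tau> v $ i = v $ \<tau> i"
  by (simp add: perm_tuple_def)

lemma perm_tuple_id [simp]: "perm_tuple id v = v"
  by (simp add: vec_eq_iff)

lemma perm_tuple_inverse [simp]:
  assumes "bij \<sigma>"
  shows "perm_tuple \<sigma> (perm_tuple (inv \<sigma>) v) = v" "perm_tuple (inv \<sigma>) (perm_tuple \<sigma> v) = v"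
  using assms by (simp_all add: vec_eq_iff bij_is_inj bij_is_surj surj_f_inv_f)

lemma perm_tuple_inject:
  assumes "bij \<sigma>"
  shows "perm_tuple \<sigma> u = perm_tuple \<sigma> v \<longleftrightarrow> u = v"
  by (metis perm_tuple_inverse(2)[OF assms])

lemma perm_tuple_inv_image_iff:
  assumes "bij \<sigma>"
  shows "j \<in> perm_tuple (inv \<sigma>) ` S \<longleftrightarrow> perm_tuple \<sigma> j \<in> S"
  by (metis assms image_iff perm_tuple_inverse)

text \<open>Permuting by \<open>\<sigma>\<close> moves the basis vector at s to position
  \<open>inv \<sigma> s\<close>. This is where the seedlet of the second family of equations comes
  from.\<close>

lemma perm_tuple_b_vec:
  assumes "bij \<sigma>"
  shows "perm_tuple \<sigma> (b_vec b r s k l i) = b_vec (perm_tuple \<sigma> b) r (inv \<sigma> s) k l i"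
proof -
  have "\<sigma> j = s \<longleftrightarrow> j = inv \<sigma> s" for j
    using assms by (metis bij_inv_eq_iff)
  then show ?thesis
    by (simp add: vec_eq_iff b_vec_def pos_tuple_def axis_def)
qed

text \<open>The exchange polynomial is free of x_s, so only the explicit multiple of the basis
  vector at s remains.\<close>

lemma b_vec_direction: "b $ s = 0 \<Longrightarrow> b_vec b r s k l i $ s = - i"
  by (simp add: b_vec_def pos_tuple_def)

lemma finite_box_of [simp]: "finite (box_of \<eta>)"
proof (rule finite_imageD)
  have "vec_nth ` box_of \<eta> \<subseteq> PiE UNIV (\<lambda>i. {0..int (\<eta> $ i)})"
    by (auto simp: box_of_def)
  then show "finite (vec_nth ` box_of \<eta>)"
    by (rule finite_subset) (simp add: finite_PiE)
qed (simp add: inj_on_def vec_nth_inject)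

subsection \<open>The linear system as identities between Laurent polynomials\<close>

text \<open>
  For \<open>\<tau> = id\<close> this is a component of F; for \<open>\<tau> = inv \<sigma>\<close> it is the factor of a component of F composed
  with the cluster symmetric map that does not come from the exchange polynomial.
\<close>

definition slice_poly ::
    "('n int_tuple \<Rightarrow> rat) \<Rightarrow> 'n nat_tuple \<Rightarrow> 'n int_tuple \<Rightarrow> ('n \<Rightarrow> 'n) \<Rightarrow> 'n \<Rightarrow> int
      \<Rightarrow> 'n::{finite,linorder} laurent_pol" where
  "slice_poly a \<eta> d \<tau> p q = (\<Sum>j\<in>slice p q (box_of \<eta>). Poly_Mapping.single (perm_tuple \<tau> j - d) (a j))"

text \<open>The expansion of (P / x_s^2)^k in monomials, P being the exchange polynomial.\<close>

definition exchange_laurent ::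
    "'n int_tuple \<Rightarrow> nat \<Rightarrow> 'n \<Rightarrow> nat poly \<Rightarrow> nat \<Rightarrow> 'n::{finite,linorder} laurent_pol" where
  "exchange_laurent b r s Z k =
     (\<Sum>l\<le>k * r. Poly_Mapping.single (b_vec b r s k l (2 * int k)) (of_nat (c_coeff r Z k l)))"

lemma tuple_power_axis: "tuple_power y (c *s axis s 1) = y s powi c"
proof -
  have "tuple_power y (c *s axis s 1) = (\<Prod>i\<in>UNIV. if i = s then y i powi c else 1)"
    unfolding tuple_power_def by (intro prod.cong) (simp_all add: axis_def)
  then show ?thesis
    by simp
qed

lemma laurent_subst_exchange_laurent:
  assumes "degree Z \<le> r"
  shows "laurent_subst (exchange_laurent b r s Z k) rat_fun_var
    = (exchange_poly b r Z / rat_fun_var s ^ 2) ^ k"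
proof -
  let ?X = "tuple_power rat_fun_var"
  let ?u = "int r *s pos_tuple (- b)" and ?w = "(- 2) *s axis s 1"
  have X_axis: "?X ?w = 1 / rat_fun_var s ^ 2"
    by (simp only: tuple_power_axis) (simp add: power_int_minus divide_inverse)
  \<comment> \<open>Because [b]_+ - [-b]_+ = b, the exponent is affine in l with slope b; the sum
    over l thus becomes the value of Z^k at x^b.\<close>
  have split: "b_vec b r s k l (2 * int k) = int k *s (?u + ?w) + int l *s b" for l
    by (simp add: vec_eq_iff b_vec_def pos_tuple_def algebra_simps max_def)
  have "degree (Z ^ k) \<le> k * r"
    using degree_power_le[of Z k] assms by (metis le_trans mult.commute mult_le_mono2)
  then have "poly (map_poly of_nat Z) (?X b) ^ k = (\<Sum>l\<le>k * r. of_nat (coeff (Z ^ k) l) * ?X b ^ l)"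
    by (simp add: poly_map_of_nat_eq_sum flip: poly_power map_poly_of_nat_power)
  moreover have "laurent_subst (exchange_laurent b r s Z k) rat_fun_var
      = (\<Sum>l\<le>k * r. of_nat (coeff (Z ^ k) l) * (?X (?u + ?w) ^ k * ?X b ^ l))"
    using assms
    by (simp add: exchange_laurent_def laurent_subst_sum laurent_subst_single split
        tuple_power_add[of rat_fun_var "int k *s _"] tuple_power_of_nat c_coeff_eq_coeff_power)
  moreover have "?X (?u + ?w) = ?X ?u / rat_fun_var s ^ 2"
    by (simp add: tuple_power_add X_axis)
  ultimately show ?thesis
    by (simp add: exchange_poly_def power_mult_distrib power_divide sum_distrib_left
        sum_divide_distrib mult_ac)
qed

text \<open>Different l may give the same exponent, for instance when b = 0, but all coefficients
  are nonnegative and the one for l = 0 is positive, so nothing cancels.\<close>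

lemma exchange_laurent_nonzero:
  assumes "coeff Z 0 > 0" and "degree Z \<le> r"
  shows "exchange_laurent b r s Z 1 \<noteq> 0"
proof -
  let ?\<beta> = "\<lambda>l. b_vec b r s 1 l 2"
  have "0 < of_nat (c_coeff r Z 1 0) * (1::rat)"
    using assms by (simp add: c_coeff_eq_coeff_power)
  also have "\<dots> = Poly_Mapping.lookup (Poly_Mapping.single (?\<beta> 0) (of_nat (c_coeff r Z 1 0))) (?\<beta> 0)"
    by simp
  also have "\<dots> \<le> (\<Sum>l\<le>r. Poly_Mapping.lookup (Poly_Mapping.single (?\<beta> l) (of_nat (c_coeff r Z 1 l))) (?\<beta> 0))"
    by (intro member_le_sum) (simp_all add: lookup_single when_def)
  also have "\<dots> = Poly_Mapping.lookup (exchange_laurent b r s Z 1) (?\<beta> 0)"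
    by (simp add: exchange_laurent_def lookup_sum)
  finally show ?thesis
    by auto
qed

lemma lookup_slice_poly:
  assumes "bij \<tau>"
  shows "Poly_Mapping.lookup (slice_poly a \<eta> d \<tau> p q) (perm_tuple \<tau> j - d)
    = (if j \<in> box_of \<eta> \<and> j $ p = q then a j else 0)"
proof -
  have "Poly_Mapping.lookup (slice_poly a \<eta> d \<tau> p q) (perm_tuple \<tau> j - d)
      = (\<Sum>i\<in>slice p q (box_of \<eta>). if i = j then a i else 0)"
    by (simp add: slice_poly_def lookup_sum lookup_single when_def perm_tuple_inject[OF assms])
  moreover have "finite (slice p q (box_of \<eta>))"
    by (simp add: slice_def)
  ultimately show ?thesis
    by (simp add: slice_def)
qed

text \<open>The product is a convolution, and pulling its shifts through \<open>\<tau>\<close> turns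
  them into those of the permuted seedlet. Each shift lowers the degree in the distinguished
  variable by 2k. Taking \<open>\<tau>\<close> to be \<open>id\<close> or
  \<open>inv \<sigma>\<close> serves the two families of equations.\<close>

lemma lookup_exchange_laurent_mult_slice_poly:
  assumes \<tau>: "bij \<tau>" and b: "b $ s = 0"
  shows "Poly_Mapping.lookup (exchange_laurent b r s Z k * slice_poly a \<eta> d \<tau> (\<tau> s) q) (perm_tuple \<tau> j - d)
    = (if j $ \<tau> s = q - 2 * int k then HLE_sum a (\<tau> s) (perm_tuple (inv \<tau>) b) r Z \<eta> k j else 0)"
proof -
  let ?\<beta> = "\<lambda>l. b_vec b r s k l (2 * int k)"
  let ?\<beta>' = "\<lambda>l. b_vec (perm_tuple (inv \<tau>) b) r (\<tau> s) k l (2 * int k)"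
  have \<beta>': "?\<beta>' l = perm_tuple (inv \<tau>) (?\<beta> l)" for l
    using \<tau> by (simp add: perm_tuple_b_vec bij_imp_bij_inv inv_inv_eq)
  have shift: "perm_tuple \<tau> j - d - ?\<beta> l = perm_tuple \<tau> (j - ?\<beta>' l) - d" for l
    using \<tau> by (simp add: \<beta>' vec_eq_iff bij_is_inj)
  have dir: "(j - ?\<beta>' l) $ \<tau> s = q \<longleftrightarrow> j $ \<tau> s = q - 2 * int k" for l
    using \<tau> b by (auto simp: b_vec_direction bij_is_inj)
  have "Poly_Mapping.lookup (exchange_laurent b r s Z k * slice_poly a \<eta> d \<tau> (\<tau> s) q) (perm_tuple \<tau> j - d)
      = (\<Sum>l\<le>k * r. of_nat (c_coeff r Z k l) *
          (if j - ?\<beta>' l \<in> box_of \<eta> \<and> j $ \<tau> s = q - 2 * int k then a (j - ?\<beta>' l) else 0))"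
    by (simp add: exchange_laurent_def sum_distrib_right lookup_sum lookup_single_mult
        shift lookup_slice_poly[OF \<tau>] dir del: vector_minus_component)
  also have "\<dots> = (if j $ \<tau> s = q - 2 * int k then HLE_sum a (\<tau> s) (perm_tuple (inv \<tau>) b) r Z \<eta> k j else 0)"
    by (auto simp: HLE_sum_def mult.commute intro!: sum.mono_neutral_cong_right split: if_splits)
  finally show ?thesis .
qed

lemma laurent_pol_eq_iff_perm:
  fixes F G :: "'n::{finite,linorder} laurent_pol"
  assumes "bij \<tau>"
  shows "F = G \<longleftrightarrow>
    (\<forall>j. Poly_Mapping.lookup F (perm_tuple \<tau> j - d) = Poly_Mapping.lookup G (perm_tuple \<tau> j - d))"
proof
  assume *: "\<forall>j. Poly_Mapping.lookup F (perm_tuple \<tau> j - d) = Poly_Mapping.lookup G (perm_tuple \<tau> j - d)"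
  show "F = G"
  proof (rule poly_mapping_eqI)
    fix v
    show "Poly_Mapping.lookup F v = Poly_Mapping.lookup G v"
      using *[rule_format, of "perm_tuple (inv \<tau>) (v + d)"] assms by simp
  qed
qed simp

text \<open>The three kinds of equations are one equation in which absent terms count as 0: outside
  \<open>U_set\<close> the sum over l is empty, and for j outside both sets the equation is 0 =
  0.\<close>

lemma HLE_k_iff:
  assumes "bij \<sigma>"
  shows "HLE_k a \<sigma> s b r Z \<eta> d k \<longleftrightarrow>
    (\<forall>j. j $ s = d $ s - int k \<longrightarrow>
      (if perm_tuple \<sigma> j \<in> box_of \<eta> then a (perm_tuple \<sigma> j) else 0) = HLE_sum a s b r Z \<eta> k j)"
proof -
  have outside: "HLE_sum a s b r Z \<eta> k j = 0" if "j \<notin> U_set s b r \<eta> k" for j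
  proof -
    have "{l. l \<le> k * r \<and> j - b_vec b r s k l (2 * int k) \<in> box_of \<eta>} = {}"
      using that by (force simp: U_set_def image_iff)
    then show ?thesis
      unfolding HLE_sum_def by (simp only: sum.empty)
  qed
  show ?thesis
    unfolding HLE_k_def Let_def slice_def using assms outside
    by (fastforce simp: perm_tuple_inv_image_iff)
qed

text \<open>Coefficients are compared at the exponents \<open>j - d\<close>. Both sides live in
  x_s-degree -k: on the right, degree k is lowered by 2k.\<close>

lemma slice_poly_eq_iff_HLE_k:
  assumes \<sigma>: "bij \<sigma>" and b: "b $ s = 0"
  shows "slice_poly a \<eta> d (inv \<sigma>) (inv \<sigma> s) (d $ s - int k)
      = exchange_laurent b r s Z k * slice_poly a \<eta> d id s (d $ s + int k)
    \<longleftrightarrow> HLE_k a \<sigma> s b r Z \<eta> d k"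
proof -
  have "Poly_Mapping.lookup (slice_poly a \<eta> d (inv \<sigma>) (inv \<sigma> s) (d $ s - int k)) (j - d)
      = (if perm_tuple \<sigma> j \<in> box_of \<eta> \<and> j $ s = d $ s - int k then a (perm_tuple \<sigma> j) else 0)" for j
    using lookup_slice_poly[OF bij_imp_bij_inv[OF \<sigma>], of a \<eta> d _ _ "perm_tuple \<sigma> j"] \<sigma>
    by (simp add: bij_is_surj surj_f_inv_f)
  moreover have "Poly_Mapping.lookup (exchange_laurent b r s Z k * slice_poly a \<eta> d id s (d $ s + int k)) (j - d)
      = (if j $ s = d $ s - int k then HLE_sum a s b r Z \<eta> k j else 0)" for j
    using lookup_exchange_laurent_mult_slice_poly[OF bij_id b, of r Z k a \<eta> d "d $ s + int k" j] by simp
  ultimately show ?thesis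
    unfolding HLE_k_iff[OF \<sigma>] laurent_pol_eq_iff_perm[OF bij_id, where d = d] by auto
qed

text \<open>Now the product is on the side of the permuted slices, so coefficients are read at
  \<open>perm_tuple (inv \<sigma>) j - d\<close>, which makes j the index of the inverse system.
  That system slices at d_t - k, whence the assumption d_t = d_s.\<close>

lemma exchange_laurent_mult_slice_poly_eq_iff_HLE_k:
  assumes \<sigma>: "bij \<sigma>" and b: "b $ s = 0" and d: "d $ inv \<sigma> s = d $ s"
  shows "exchange_laurent b r s Z k * slice_poly a \<eta> d (inv \<sigma>) (inv \<sigma> s) (d $ s + int k)
      = slice_poly a \<eta> d id s (d $ s - int k)
    \<longleftrightarrow> HLE_k a (inv \<sigma>) (inv \<sigma> s) (perm_tuple \<sigma> b) r Z \<eta> d k"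
proof -
  note \<sigma>' = bij_imp_bij_inv[OF \<sigma>]
  have "Poly_Mapping.lookup (slice_poly a \<eta> d id s (d $ s - int k)) (perm_tuple (inv \<sigma>) j - d)
      = (if perm_tuple (inv \<sigma>) j \<in> box_of \<eta> \<and> j $ inv \<sigma> s = d $ s - int k
         then a (perm_tuple (inv \<sigma>) j) else 0)" for j
    using lookup_slice_poly[OF bij_id, of a \<eta> d _ _ "perm_tuple (inv \<sigma>) j"] by simp
  moreover have "Poly_Mapping.lookup
        (exchange_laurent b r s Z k * slice_poly a \<eta> d (inv \<sigma>) (inv \<sigma> s) (d $ s + int k))
        (perm_tuple (inv \<sigma>) j - d)
      = (if j $ inv \<sigma> s = d $ s - int k then HLE_sum a (inv \<sigma> s) (perm_tuple \<sigma> b) r Z \<eta> k j else 0)" for j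
    using lookup_exchange_laurent_mult_slice_poly[OF \<sigma>' b, of r Z k a \<eta> d "d $ s + int k" j] \<sigma>
    by (simp add: inv_inv_eq)
  ultimately show ?thesis
    unfolding HLE_k_iff[OF \<sigma>'] laurent_pol_eq_iff_perm[OF \<sigma>', where d = d] d by auto
qed

subsection \<open>Comparing degrees in one variable\<close>

text \<open>Zero counts as homogeneous of every degree, so components may vanish.\<close>

definition homogeneous_in :: "'n \<Rightarrow> int \<Rightarrow> 'n::{finite,linorder} laurent_pol \<Rightarrow> bool" where
  "homogeneous_in s e F \<longleftrightarrow> (\<forall>v. Poly_Mapping.lookup F v \<noteq> 0 \<longrightarrow> v $ s = e)"

lemma homogeneous_in_single: "v $ s = e \<Longrightarrow> homogeneous_in s e (Poly_Mapping.single v c)"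
  by (simp add: homogeneous_in_def lookup_single when_def)

lemma homogeneous_in_sum:
  "(\<And>x. x \<in> A \<Longrightarrow> homogeneous_in s e (f x)) \<Longrightarrow> homogeneous_in s e (sum f A)"
  unfolding homogeneous_in_def lookup_sum by (metis sum.neutral)

lemma homogeneous_in_mult:
  assumes "homogeneous_in s e F" and "homogeneous_in s e' G"
  shows "homogeneous_in s (e + e') (F * G)"
  using assms keys_mult[of F G] by (fastforce simp: homogeneous_in_def simp flip: in_keys_iff)

lemma homogeneous_in_exchange_laurent:
  "b $ s = 0 \<Longrightarrow> homogeneous_in s (- 2 * int k) (exchange_laurent b r s Z k)"
  unfolding exchange_laurent_def
  by (intro homogeneous_in_sum homogeneous_in_single) (simp add: b_vec_direction)

lemma homogeneous_in_slice_poly: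
  "homogeneous_in s (q - d $ s) (slice_poly a \<eta> d \<tau> (\<tau> s) q)"
  unfolding slice_poly_def
  by (intro homogeneous_in_sum homogeneous_in_single) (simp add: slice_def)

text \<open>As \<open>g\<close> is injective, a monomial whose s-degree is \<open>g e\<close> can
  occur only in the summand with index \<open>e\<close>.\<close>

lemma homogeneous_components_eq:
  assumes "finite E" and "e \<in> E" and "inj_on g E" and "sum A E = sum B E"
    and "\<And>e. e \<in> E \<Longrightarrow> homogeneous_in s (g e) (A e)"
    and "\<And>e. e \<in> E \<Longrightarrow> homogeneous_in s (g e) (B e)"
  shows "A e = B e"
proof (rule poly_mapping_eqI)
  fix v
  show "Poly_Mapping.lookup (A e) v = Poly_Mapping.lookup (B e) v"
  proof (cases "v $ s = g e")
    case True
    have *: "Poly_Mapping.lookup (sum C E) v = Poly_Mapping.lookup (C e) v"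
      if C: "\<And>e. e \<in> E \<Longrightarrow> homogeneous_in s (g e) (C e)" for C
    proof -
      have "Poly_Mapping.lookup (C e') v = 0" if "e' \<in> E" "e' \<noteq> e" for e'
        using C[OF that(1)] True that assms(2,3) by (auto simp: homogeneous_in_def inj_on_def)
      then have "(\<Sum>e'\<in>E. Poly_Mapping.lookup (C e') v)
          = (\<Sum>e'\<in>E. if e' = e then Poly_Mapping.lookup (C e') v else 0)"
        by (intro sum.cong) auto
      then show ?thesis
        using assms(1,2) by (simp add: lookup_sum)
    qed
    show ?thesis
      using *[of A] *[of B] assms by simp
  next
    case False
    then show ?thesis
      using assms(2,5,6) unfolding homogeneous_in_def by metis
  qed
qed

subsection \<open>Composition with the cluster symmetric map\<close>

text \<open>Writing P / x_s = x_s * (P / x_s^2) exhibits the map as a permutation of the variables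
  followed by a scaling of the component at \<open>inv \<sigma> s\<close> alone.\<close>

lemma tuple_power_cluster_sym_map:
  assumes \<sigma>: "bij \<sigma>"
  shows "tuple_power (cluster_sym_map \<sigma> s b r Z) v
    = tuple_power rat_fun_var (perm_tuple (inv \<sigma>) v)
      * (exchange_poly b r Z / rat_fun_var s ^ 2) powi (v $ inv \<sigma> s)"
proof -
  let ?Q = "exchange_poly b r Z / rat_fun_var s ^ 2" and ?t = "inv \<sigma> s"
  have "cluster_sym_map \<sigma> s b r Z i = rat_fun_var (\<sigma> i) * (if i = ?t then ?Q else 1)" for i
    using \<sigma> by (simp add: cluster_sym_map_def bij_is_surj surj_f_inv_f power2_eq_square)
  then have "tuple_power (cluster_sym_map \<sigma> s b r Z) v
      = (\<Prod>i\<in>UNIV. rat_fun_var (\<sigma> i) powi (v $ i)) * (\<Prod>i\<in>UNIV. if i = ?t then ?Q powi (v $ i) else 1)"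
    unfolding tuple_power_def
    by (simp add: power_int_mult_distrib prod.distrib if_distrib[of "\<lambda>x. x powi _"] cong: if_cong)
  also have "(\<Prod>i\<in>UNIV. rat_fun_var (\<sigma> i) powi (v $ i)) = tuple_power rat_fun_var (perm_tuple (inv \<sigma>) v)"
    unfolding tuple_power_def using \<sigma>
    by (intro prod.reindex_bij_witness[where i = "inv \<sigma>" and j = \<sigma>])
      (simp_all add: bij_is_inj bij_is_surj surj_f_inv_f)
  finally show ?thesis
    by simp
qed

theorem theorem1p1:
  fixes \<sigma> :: "'n::{finite,linorder} \<Rightarrow> 'n" and s t :: 'n
    and b :: "'n int_tuple" and r :: nat and Z :: "nat poly"
    and \<eta> :: "'n nat_tuple" and d :: "'n int_tuple"
    and F :: "'n laurent_pol" and a :: "'n int_tuple \<Rightarrow> rat"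
  assumes data: "is_data \<sigma> s b r Z"
    and t: "t = inv \<sigma> s"
    and d: "d = perm_tuple \<sigma> d"
    and \<eta>: "int (\<eta> $ s) = int (\<eta> $ t)" "int (\<eta> $ t) = 2 * d $ s" "2 * d $ s = 2 * d $ t"
    and type: "of_type F \<eta> d"
    and expansion: "F = laurent_monom 1 (- d) * (\<Sum>j\<in>box_of \<eta>. laurent_monom (a j) j)"
  shows "laurent_subst F (cluster_sym_map \<sigma> s b r Z) = laurent_subst F rat_fun_var
    \<longleftrightarrow> HLE a \<sigma> s b r Z \<eta> d"
proof -
  have \<sigma>: "bij \<sigma>" and b: "b $ s = 0" and Z: "degree Z \<le> r" "coeff Z 0 > 0"
    using data by (auto simp: is_data_def is_seedlet_def)
  define D where "D = d $ s"
  \<comment> \<open>Nonnegativity holds because 2D is the natural number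
    \<open>\<eta> $ t\<close>.\<close>
  have D: "0 \<le> D" "d $ t = D" "int (\<eta> $ s) = 2 * D" "int (\<eta> $ t) = 2 * D"
    using \<eta> by (simp_all add: D_def)
  define E where "E = {- D..D}"
  define Q :: "'n rat_fun" where "Q = exchange_poly b r Z / rat_fun_var s ^ 2"
  \<comment> \<open>The opposite signs in \<open>D - e\<close> and \<open>D + e\<close> match
    degrees: Q^(-e) has x_s-degree 2e and \<open>G e\<close> has -e, which together give the degree
    e of \<open>H e\<close>.\<close>
  define G where "G e = slice_poly a \<eta> d (inv \<sigma>) t (D - e)" for e
  define H where "H e = slice_poly a \<eta> d id s (D + e)" for e
  let ?\<Phi> = "\<lambda>F. laurent_subst F rat_fun_var"
  let ?L = "exchange_laurent b r s Z"
  have \<Phi>_mult: "?\<Phi> (A * B) = ?\<Phi> A * ?\<Phi> B" for A B :: "'n laurent_pol"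
    by (simp add: laurent_subst_mult)
  have \<Phi>_L: "?\<Phi> (?L k) = Q ^ k" for k
    using laurent_subst_exchange_laurent[OF Z(1)] by (simp add: Q_def)
  have Q: "Q \<noteq> 0"
    using \<Phi>_L[of 1] exchange_laurent_nonzero[OF Z(2,1), of b s]
      laurent_subst_var_eq_0_iff[of "?L 1"] by auto
  have inv_d: "perm_tuple (inv \<sigma>) d = d"
    using d perm_tuple_inverse(2)[OF \<sigma>] by metis
  have F: "F = (\<Sum>j\<in>box_of \<eta>. Poly_Mapping.single (j - d) (a j))"
    unfolding expansion laurent_monom_def sum_distrib_left by (simp add: mult_single)

  \<comment> \<open>Monomials are grouped by e = D - j_t, the negative of the power of Q they
    acquire; invariance of d lets the permutation act on j alone.\<close>
  have lhs: "laurent_subst F (cluster_sym_map \<sigma> s b r Z) = (\<Sum>e\<in>E. Q powi (- e) * ?\<Phi> (G e))"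
  proof -
    have "perm_tuple (inv \<sigma>) (j - d) = perm_tuple (inv \<sigma>) j - d" for j
      using inv_d by (simp add: vec_eq_iff)
    then have "laurent_subst F (cluster_sym_map \<sigma> s b r Z)
        = (\<Sum>j\<in>box_of \<eta>. Q powi (- (D - j $ t)) * ?\<Phi> (Poly_Mapping.single (perm_tuple (inv \<sigma>) j - d) (a j)))"
      using D t by (simp add: F laurent_subst_sum laurent_subst_single
          tuple_power_cluster_sym_map[OF \<sigma>] mult_ac flip: Q_def)
    also have "\<dots> = (\<Sum>e\<in>E. \<Sum>j | j \<in> box_of \<eta> \<and> D - j $ t = e.
        Q powi (- (D - j $ t)) * ?\<Phi> (Poly_Mapping.single (perm_tuple (inv \<sigma>) j - d) (a j)))"
    proof (rule sum.group[symmetric])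
      have "0 \<le> j $ t \<and> j $ t \<le> 2 * D" if "j \<in> box_of \<eta>" for j
        using that by (simp add: box_of_def flip: D(4))
      then show "(\<lambda>j. D - j $ t) ` box_of \<eta> \<subseteq> E"
        by (force simp: E_def)
    qed (simp_all add: E_def)
    also have "\<dots> = (\<Sum>e\<in>E. Q powi (- e) * ?\<Phi> (G e))"
      unfolding G_def slice_poly_def slice_def laurent_subst_sum sum_distrib_left
      by (intro sum.cong) auto
    finally show ?thesis .
  qed

  have rhs: "?\<Phi> F = (\<Sum>e\<in>E. ?\<Phi> (H e))"
  proof -
    have "?\<Phi> F = (\<Sum>j\<in>box_of \<eta>. ?\<Phi> (Poly_Mapping.single (j - d) (a j)))"
      by (simp add: F laurent_subst_sum)
    also have "\<dots> = (\<Sum>e\<in>E. \<Sum>j | j \<in> box_of \<eta> \<and> j $ s - D = e. ?\<Phi> (Poly_Mapping.single (j - d) (a j)))"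
    proof (rule sum.group[symmetric])
      have "0 \<le> j $ s \<and> j $ s \<le> 2 * D" if "j \<in> box_of \<eta>" for j
        using that by (simp add: box_of_def flip: D(3))
      then show "(\<lambda>j. j $ s - D) ` box_of \<eta> \<subseteq> E"
        by (force simp: E_def)
    qed (simp_all add: E_def)
    also have "\<dots> = (\<Sum>e\<in>E. ?\<Phi> (H e))"
      unfolding H_def slice_poly_def slice_def laurent_subst_sum
      by (intro sum.cong) auto
    finally show ?thesis .
  qed

  have separate: "(\<Sum>e\<in>E. Q powi (- e) * ?\<Phi> (G e)) = (\<Sum>e\<in>E. ?\<Phi> (H e))
      \<longleftrightarrow> (\<forall>e\<in>E. Q powi (- e) * ?\<Phi> (G e) = ?\<Phi> (H e))" (is "?l \<longleftrightarrow> ?r")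
  proof
    assume ?l
    \<comment> \<open>Both sides are multiplied by Q^D. Since e is at most D, the exponent D - e is
      nonnegative and only Laurent polynomials remain, which are determined by their images in the
      field.\<close>
    define A where "A e = ?L (nat (D - e)) * G e" for e
    define B where "B e = ?L (nat D) * H e" for e
    have A: "?\<Phi> (A e) = Q ^ nat D * (Q powi (- e) * ?\<Phi> (G e))" if "e \<in> E" for e
    proof -
      have "Q ^ nat (D - e) = Q powi (D + (- e))"
        using that by (simp add: E_def power_int_def)
      also have "\<dots> = Q ^ nat D * Q powi (- e)"
        using Q D(1) by (subst power_int_add) (simp_all add: power_int_def[of Q D])
      finally show ?thesis
        by (simp add: A_def \<Phi>_mult \<Phi>_L mult.assoc)
    qed
    have B: "?\<Phi> (B e) = Q ^ nat D * ?\<Phi> (H e)" for e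
      by (simp add: B_def \<Phi>_mult \<Phi>_L)
    have "?\<Phi> (sum A E) = ?\<Phi> (sum B E)"
      using \<open>?l\<close> by (simp add: laurent_subst_sum A B flip: sum_distrib_left)
    then have sums: "sum A E = sum B E"
      by (simp add: laurent_subst_var_inject)
    \<comment> \<open>The degrees are -2(D - e) - e for \<open>A e\<close> and -2D + e for
      \<open>B e\<close>; they agree and are distinct for distinct e.\<close>
    have hom_A: "homogeneous_in s (e - 2 * D) (A e)" if "e \<in> E" for e
    proof -
      have "e - 2 * D = - 2 * int (nat (D - e)) + ((D - e) - d $ s)"
        using that by (simp add: E_def D_def)
      then show ?thesis
        unfolding A_def G_def t
        by (simp only:) (intro homogeneous_in_mult homogeneous_in_exchange_laurent b homogeneous_in_slice_poly)
    qed
    have hom_B: "homogeneous_in s (e - 2 * D) (B e)" for e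
    proof -
      have "e - 2 * D = - 2 * int (nat D) + ((D + e) - d $ s)"
        using D(1) by (simp add: D_def)
      moreover have "homogeneous_in s ((D + e) - d $ s) (H e)"
        using homogeneous_in_slice_poly[of s _ d a \<eta> id] by (simp add: H_def)
      ultimately show ?thesis
        unfolding B_def by (simp only:) (intro homogeneous_in_mult homogeneous_in_exchange_laurent b)
    qed
    have "A e = B e" if "e \<in> E" for e
      by (rule homogeneous_components_eq[where s = s and g = "\<lambda>e. e - 2 * D", OF _ that _ sums])
        (simp_all add: E_def inj_on_def hom_A[unfolded E_def] hom_B)
    then show ?r
      using A B Q by (metis mult_left_cancel power_not_zero)
  qed simp

  have pos: "Q powi (- int k) * ?\<Phi> (G (int k)) = ?\<Phi> (H (int k)) \<longleftrightarrow> HLE_k a \<sigma> s b r Z \<eta> d k" for k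
  proof -
    have "Q powi (- int k) * ?\<Phi> (G (int k)) = ?\<Phi> (H (int k))
        \<longleftrightarrow> ?\<Phi> (G (int k)) = ?\<Phi> (?L k * H (int k))"
      using Q by (simp add: \<Phi>_mult \<Phi>_L power_int_minus field_simps)
    then show ?thesis
      using slice_poly_eq_iff_HLE_k[OF \<sigma> b, of a \<eta> d k r Z]
      by (simp add: laurent_subst_var_inject G_def H_def D_def t)
  qed

  \<comment> \<open>The double negation keeps this literally the instance e = -k, as the final
    rewriting requires.\<close>
  have neg: "Q powi (- (- int k)) * ?\<Phi> (G (- int k)) = ?\<Phi> (H (- int k))
      \<longleftrightarrow> HLE_k a (inv \<sigma>) (inv \<sigma> s) (perm_tuple \<sigma> b) r Z \<eta> d k" for k
  proof -
    have "Q powi (- (- int k)) * ?\<Phi> (G (- int k)) = ?\<Phi> (?L k * G (- int k))"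
      by (simp add: \<Phi>_mult \<Phi>_L)
    then show ?thesis
      using exchange_laurent_mult_slice_poly_eq_iff_HLE_k[OF \<sigma> b, of d r Z k a \<eta>] D(2)
      by (simp add: laurent_subst_var_inject G_def H_def D_def t)
  qed

  \<comment> \<open>Every e in E is k or -k with k = |e|. At k = 0 both instances are e = 0, so the
    two systems for k = 0 express the same identity.\<close>
  have "(\<forall>e\<in>E. R e) \<longleftrightarrow> (\<forall>k::nat. int k \<le> D \<longrightarrow> R (int k) \<and> R (- int k))" for R
  proof
    assume R: "\<forall>k::nat. int k \<le> D \<longrightarrow> R (int k) \<and> R (- int k)"
    show "\<forall>e\<in>E. R e"
    proof
      fix e assume "e \<in> E"
      then show "R e"
        using R[rule_format, of "nat \<bar>e\<bar>"] by (cases "0 \<le> e") (auto simp: E_def)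
    qed
  qed (simp add: E_def)
  then have "(\<forall>e\<in>E. Q powi (- e) * ?\<Phi> (G e) = ?\<Phi> (H e)) \<longleftrightarrow> HLE a \<sigma> s b r Z \<eta> d"
    unfolding HLE_def by (simp only: pos neg D_def)
  then show ?thesis
    by (simp only: lhs rhs separate)
qed

end
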